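(* Let $\mu$ be a non-trivial probability measure supported on $[-1,1]$ with recurrence coefficients $\{b_n\}_{n\ge1}$, $\{d_n\}_{n\ge1}$, and let $\{\alpha_n\}_{n\ge0}$ be the Verblunsky coefficients of $\sigma=\mathrm{Sz}(\mu)$, with $\alpha_{-1}=-1$. Fix an integer $k\ge1$, $\lambda_k>0$ and $\tau_{k+1}\in\mathbb R$, and consider the perturbed recurrence coefficients $$\mathfrak d_n=\lambda_k^{\delta_{n,k}}d_n,\qquad \mathfrak b_n=b_n+\tau_{k+1}\delta_{n,k+1},\qquad n\ge1,$$ whose orthogonality measure is assumed to be supported on $[-1,1]$. Let $\{\widehat\alpha_n\}_{n\ge0}$ be the Verblunsky coefficients of the orthogonal polynomials on the unit circle corresponding to the perturbed coefficients through the Szegő transformation. Then $$\widehat\alpha_n=\alpha_n,\quad 0\le n<2k-1,$$ $$\widehat\alpha_{2k-1}=\alpha_{2k-1}+M,$$ $$\widehat\alpha_{2k}=\frac{(1-\alpha_{2k-1})\alpha_{2k}+2\tau_{k+1}+M\alpha_{2k-2}}{1-\alpha_{2k-1}-M},$$ $$\widehat\alpha_{2m+1}=-1+\frac{4d_{m+1}}{(1-\widehat\alpha_{2m-1})(1-\widehat\alpha_{2m}^2)},\quad m\ge k,$$ $$\widehat\alpha_{2m}=\frac{2b_{m+1}+(1+\widehat\alpha_{2m-1})\widehat\alpha_{2m-2}}{1-\widehat\alpha_{2m-1}},\quad m\ge k+1,$$ where $$M=\frac{4(\lambda_k-1)d_k}{(1-\alpha_{2k-3})(1-\alpha_{2k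-2}^2)}.$$
   Context: For a non-trivial probability measure on $[-1,1]$, the recurrence coefficients $b_n\in\mathbb R$, $d_n>0$ ($n\ge1$) are those of its monic orthogonal polynomials: $P_{n+1}(x)=(x-b_{n+1})P_n(x)-d_nP_{n-1}(x)$, $n\ge0$, $P_{-1}=0$, $P_0=1$. The perturbed polynomials are given by $g_{n+1}(x)=(x-\mathfrak b_{n+1})g_n(x)-\mathfrak d_ng_{n-1}(x)$, $g_{-1}=0$, $g_0=1$; $\delta_{n,k}$ is the Kronecker delta. Szegő transformation: a probability measure $\nu$ on $[-1,1]$ is sent to the probability measure $\mathrm{Sz}(\nu)$ on the unit circle given by $d\,\mathrm{Sz}(\nu)(\theta)=\frac12|d\nu(\cos\theta)|$, i.e. the measure invariant under $\theta\mapsto-\theta$ whose push-forward under $e^{i\theta}\mapsto\cos\theta$ is $\nu$. For a non-trivial probability measure on the unit circle with monic orthogonal polynomials $\Phi_n$, the Verblunsky coefficients are $\alpha_n=-\overline{\Phi_{n+1}(0)}$, $n\ge0$. The $\widehat\alpha_n$ are those of $\mathrm{Sz}(\widehat\mu)$, where $\widehat\mu$ is the orthogonality probability measure of $\{g_n\}$. *)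

theory Defs
  imports "HOL-Probability.Probability" "HOL-Computational_Algebra.Polynomial"
begin

definition prob_measure_on :: "'a::topological_space set \<Rightarrow> 'a measure \<Rightarrow> bool" where
  "prob_measure_on S \<nu> \<longleftrightarrow> prob_space \<nu> \<and> sets \<nu> = sets borel \<and> (AE x in \<nu>. x \<in> S)"

definition nontrivial_measure :: "'a measure \<Rightarrow> bool" where
  "nontrivial_measure \<nu> \<longleftrightarrow> \<not> (\<exists>F. finite F \<and> (AE x in \<nu>. x \<in> F))"

definition monic_ops_line :: "real measure \<Rightarrow> (nat \<Rightarrow> real poly) \<Rightarrow> bool" where
  "monic_ops_line \<nu> P \<longleftrightarrow>
     (\<forall>n. degree (P n) = n \<and> lead_coeff (P n) = 1) \<and>
     (\<forall>m n. m \<noteq> n \<longrightarrow> (\<integral>x. poly (P m) x * poly (P n) x \<partial>\<nu>) = 0)"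

text \<open>The coefficients are indexed from 1; the values \<open>b 0\<close> and \<open>d 0\<close> are never used
  (\<open>d 0\<close> would multiply \<open>P\<^sub>-\<^sub>1 = 0\<close>).\<close>

fun three_term_poly :: "(nat \<Rightarrow> real) \<Rightarrow> (nat \<Rightarrow> real) \<Rightarrow> nat \<Rightarrow> real poly" where
  "three_term_poly b d 0 = 1"
| "three_term_poly b d (Suc 0) = [:- b 1, 1:]"
| "three_term_poly b d (Suc (Suc n)) =
     [:- b (n + 2), 1:] * three_term_poly b d (Suc n) - smult (d (n + 1)) (three_term_poly b d n)"

definition recurrence_coeffs :: "real measure \<Rightarrow> (nat \<Rightarrow> real) \<Rightarrow> (nat \<Rightarrow> real) \<Rightarrow> bool" where
  "recurrence_coeffs \<nu> b d \<longleftrightarrow> (\<forall>n\<ge>1. 0 < d n) \<and> monic_ops_line \<nu> (three_term_poly b d)"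

definition monic_ops_circle :: "complex measure \<Rightarrow> (nat \<Rightarrow> complex poly) \<Rightarrow> bool" where
  "monic_ops_circle \<sigma> \<Phi> \<longleftrightarrow>
     (\<forall>n. degree (\<Phi> n) = n \<and> lead_coeff (\<Phi> n) = 1) \<and>
     (\<forall>m n. m \<noteq> n \<longrightarrow> (\<integral>z. poly (\<Phi> m) z * cnj (poly (\<Phi> n) z) \<partial>\<sigma>) = 0)"

definition monic_opuc :: "complex measure \<Rightarrow> nat \<Rightarrow> complex poly" where
  "monic_opuc \<sigma> = (THE \<Phi>. monic_ops_circle \<sigma> \<Phi>)"

text \<open>Integer indices accommodate the convention \<open>\<alpha>\<^sub>-\<^sub>1 = -1\<close>; indices below \<open>-1\<close> are
  meaningless.\<close>

definition verblunsky :: "complex measure \<Rightarrow> int \<Rightarrow> complex" where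
  "verblunsky \<sigma> n = (if n = -1 then -1 else - cnj (poly (monic_opuc \<sigma> (nat (n + 1))) 0))"

text \<open>The upper and the lower semicircle each carry half of \<open>\<nu>\<close>, transported by
  \<open>x = cos \<theta>\<close>: this is the law of \<open>exp (i s arccos x)\<close> for \<open>x\<close> distributed according to \<open>\<nu>\<close>
  and an independent uniform sign \<open>s\<close>.\<close>

definition Sz :: "real measure \<Rightarrow> complex measure" where
  "Sz \<nu> = distr (measure_pmf (pmf_of_set {1, -1 :: real}) \<Otimes>\<^sub>M \<nu>) borel
            (\<lambda>(s, x). cis (s * arccos x))"

lemma borel_measurable_arccos [measurable]: "arccos \<in> borel_measurable borel"
proof -
  have out: "arccos x = arccos 2" if "x \<notin> {-1..1}" for x
  proof -
    have "(\<lambda>t. 0 \<le> t \<and> t \<le> pi \<and> cos t = x) = (\<lambda>t. 0 \<le> t \<and> t \<le> pi \<and> cos t = 2)"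
    proof
      fix t show "(0 \<le> t \<and> t \<le> pi \<and> cos t = x) = (0 \<le> t \<and> t \<le> pi \<and> cos t = 2)"
        using that cos_le_one[of t] cos_ge_minus_one[of t] by (auto simp del: cos_le_one cos_ge_minus_one)
    qed
    then show ?thesis by (simp add: arccos_def)
  qed
  have "(\<lambda>x. if x \<in> {-1..1} then arccos x else arccos 2) \<in> borel_measurable borel"
    by (intro borel_measurable_continuous_on_if continuous_on_arccos' continuous_on_const) auto
  also have "(\<lambda>x. if x \<in> {-1..1} then arccos x else arccos 2) = arccos"
  proof
    fix x show "(if x \<in> {-1..1} then arccos x else arccos 2) = arccos x"
      using out[of x] by (cases "x \<in> {-1..1}") auto
  qed
  finally show ?thesis .
qed

lemma borel_measurable_cis [measurable]: "cis \<in> borel_measurable borel"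
  by (intro borel_measurable_continuous_onI continuous_intros)

lemma measurable_Sz_map:
  assumes "sets \<nu> = sets borel"
  shows "(\<lambda>(s, x). cis (s * arccos x)) \<in>
           borel_measurable (measure_pmf (pmf_of_set {1, -1 :: real}) \<Otimes>\<^sub>M \<nu>)"
proof -
  note assms [measurable_cong]
  have [measurable]: "(\<lambda>s. s) \<in> borel_measurable (measure_pmf (pmf_of_set {1, -1 :: real}))"
    by simp
  show ?thesis by measurable
qed

lemma prob_measure_on_Sz:
  assumes "prob_measure_on {-1..1} \<nu>"
  shows "prob_measure_on (sphere 0 1) (Sz \<nu>)"
proof -
  let ?p = "measure_pmf (pmf_of_set {1, -1 :: real})"
  have s: "sets \<nu> = sets borel" and "prob_space \<nu>" using assms by (auto simp: prob_measure_on_def)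
  interpret \<nu>: prob_space \<nu> by fact
  interpret pair_prob_space ?p \<nu> ..
  have "prob_space (Sz \<nu>)"
    unfolding Sz_def by (rule prob_space_distr[OF measurable_Sz_map[OF s]])
  moreover have "AE z in Sz \<nu>. z \<in> sphere 0 1"
    unfolding Sz_def by (subst AE_distr_iff[OF measurable_Sz_map[OF s]]) (auto simp: split_beta)
  moreover have "sets (Sz \<nu>) = sets borel" by (simp add: Sz_def)
  ultimately show ?thesis by (simp only: prob_measure_on_def)
qed

lemma distr_Re_Sz:
  assumes "prob_measure_on {-1..1} \<nu>"
  shows "distr (Sz \<nu>) borel Re = \<nu>"
proof (rule measure_eqI)
  let ?p = "measure_pmf (pmf_of_set {1, -1 :: real})"
  have s [measurable_cong]: "sets \<nu> = sets borel" and "prob_space \<nu>"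
    and ae: "AE x in \<nu>. x \<in> {-1..1}"
    using assms by (auto simp: prob_measure_on_def)
  interpret \<nu>: prob_space \<nu> by fact
  show "sets (distr (Sz \<nu>) borel Re) = sets \<nu>" by (simp add: s)
  fix A assume "A \<in> sets (distr (Sz \<nu>) borel Re)"
  then have A [measurable]: "A \<in> sets borel" by simp
  have [measurable]: "(\<lambda>s. s) \<in> borel_measurable ?p" by simp
  have "emeasure (distr (Sz \<nu>) borel Re) A =
      (\<integral>\<^sup>+z. indicator A (Re (cis (fst z * arccos (snd z)))) \<partial>(?p \<Otimes>\<^sub>M \<nu>))"
    unfolding Sz_def
    by (subst nn_integral_indicator[symmetric], simp,
        subst nn_integral_distr, simp, simp,
        subst nn_integral_distr[OF measurable_Sz_map[OF s]], simp, simp add: split_beta)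
  also have "\<dots> = (\<integral>\<^sup>+s. \<integral>\<^sup>+x. indicator A (Re (cis (s * arccos x))) \<partial>\<nu> \<partial>?p)"
    by (subst \<nu>.nn_integral_fst[symmetric]) simp_all
  also have "\<dots> = (\<integral>\<^sup>+s. \<integral>\<^sup>+x. indicator A x \<partial>\<nu> \<partial>?p)"
  proof (rule nn_integral_cong_AE, rule AE_pmfI, rule nn_integral_cong_AE)
    fix t assume "t \<in> set_pmf (pmf_of_set {1, -1 :: real})"
    then have "t = 1 \<or> t = -1" by simp
    with ae show "AE x in \<nu>. indicator A (Re (cis (t * arccos x))) = (indicator A x :: ennreal)"
      by (elim eventually_mono) (auto simp: cis.sel)
  qed
  also have "\<dots> = emeasure \<nu> A"
    by (simp add: s measure_pmf.emeasure_space_1[simplified])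
  finally show "emeasure (distr (Sz \<nu>) borel Re) A = emeasure \<nu> A" .
qed

lemma distr_cnj_Sz:
  assumes "prob_measure_on {-1..1} \<nu>"
  shows "distr (Sz \<nu>) borel cnj = Sz \<nu>"
proof (rule measure_eqI)
  let ?p = "measure_pmf (pmf_of_set {1, -1 :: real})"
  have s [measurable_cong]: "sets \<nu> = sets borel" and "prob_space \<nu>"
    using assms by (auto simp: prob_measure_on_def)
  interpret \<nu>: prob_space \<nu> by fact
  show "sets (distr (Sz \<nu>) borel cnj) = sets (Sz \<nu>)" by (simp add: Sz_def)
  fix A assume "A \<in> sets (distr (Sz \<nu>) borel cnj)"
  then have A [measurable]: "A \<in> sets borel" by simp
  have [measurable]: "cnj \<in> borel_measurable borel"
    by (intro borel_measurable_continuous_onI continuous_intros)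
  have [measurable]: "(\<lambda>s. s) \<in> borel_measurable ?p" by simp
  have "emeasure (distr (Sz \<nu>) borel cnj) A =
      (\<integral>\<^sup>+z. indicator A (cnj (cis (fst z * arccos (snd z)))) \<partial>(?p \<Otimes>\<^sub>M \<nu>))"
    unfolding Sz_def
    by (subst nn_integral_indicator[symmetric], simp,
        subst nn_integral_distr, simp, simp,
        subst nn_integral_distr[OF measurable_Sz_map[OF s]], simp, simp add: split_beta)
  also have "\<dots> = (\<integral>\<^sup>+s. \<integral>\<^sup>+x. indicator A (cnj (cis (s * arccos x))) \<partial>\<nu> \<partial>?p)"
    by (subst \<nu>.nn_integral_fst[symmetric]) simp_all
  also have "\<dots> = (\<integral>\<^sup>+s. \<integral>\<^sup>+x. indicator A (cis (s * arccos x)) \<partial>\<nu> \<partial>?p)"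
    by (simp add: nn_integral_pmf_of_set cis_cnj add.commute)
  also have "\<dots> = (\<integral>\<^sup>+z. indicator A (cis (fst z * arccos (snd z))) \<partial>(?p \<Otimes>\<^sub>M \<nu>))"
    by (subst \<nu>.nn_integral_fst[symmetric]) simp_all
  also have "\<dots> = emeasure (Sz \<nu>) A"
    unfolding Sz_def
    by (subst nn_integral_indicator[symmetric], simp,
        subst nn_integral_distr[OF measurable_Sz_map[OF s]], simp, simp add: split_beta)
  finally show "emeasure (distr (Sz \<nu>) borel cnj) A = emeasure (Sz \<nu>) A" .
qed

end

theory Submission
  imports Defs
begin

text \<open>Everything follows from the Geronimus relations for \<open>\<sigma> = Sz \<nu>\<close>,
  \<open>4 d\<^sub>m\<^sub>+\<^sub>1 = (1 - \<alpha>\<^sub>2\<^sub>m\<^sub>-\<^sub>1) (1 - \<alpha>\<^sub>2\<^sub>m\<^sup>2) (1 + \<alpha>\<^sub>2\<^sub>m\<^sub>+\<^sub>1)\<close> and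
  \<open>2 b\<^sub>m\<^sub>+\<^sub>1 = (1 - \<alpha>\<^sub>2\<^sub>m\<^sub>-\<^sub>1) \<alpha>\<^sub>2\<^sub>m - (1 + \<alpha>\<^sub>2\<^sub>m\<^sub>-\<^sub>1) \<alpha>\<^sub>2\<^sub>m\<^sub>-\<^sub>2\<close>,
  which determine the Verblunsky coefficients recursively from \<open>b\<close> and \<open>d\<close>.
  On the unit circle \<open>(2 z)\<^sup>n P\<^sub>n (Re z)\<close> is a monic polynomial of degree \<open>2 n\<close> with constant
  term 1 which is orthogonal to \<open>z, \<dots>, z\<^sup>2\<^sup>n\<^sup>-\<^sup>1\<close>; so is \<open>z \<Phi>\<^sub>2\<^sub>n\<^sub>-\<^sub>1 + \<Phi>\<^sup>*\<^sub>2\<^sub>n\<^sub>-\<^sub>1\<close>,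
  hence the two coincide. Comparing their norms gives the first relation, comparing their
  coefficients of \<open>z\<close> the second.\<close>

section \<open>Integrability and degree bounds\<close>

lemma integrable_continuous_on_compact_support:
  fixes f :: "'a::topological_space \<Rightarrow> 'b::{banach, second_countable_topology}"
  assumes \<nu>: "prob_measure_on K \<nu>" and K: "compact K" and f: "continuous_on UNIV f"
  shows "integrable \<nu> f"
proof -
  interpret prob_space \<nu> using \<nu> by (simp add: prob_measure_on_def)
  have s: "sets \<nu> = sets borel" and ae: "AE x in \<nu>. x \<in> K"
    using \<nu> by (auto simp: prob_measure_on_def)
  have "compact (f ` K)"
    using K f by (meson compact_continuous_image continuous_on_subset subset_UNIV)
  then have "\<exists>B. \<forall>x\<in>K. norm (f x) \<le> B"
    by (auto dest!: compact_imp_bounded simp: bounded_iff)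
  then obtain B where B: "\<And>x. x \<in> K \<Longrightarrow> norm (f x) \<le> B"
    by blast
  show ?thesis
  proof (rule integrable_const_bound)
    show "AE x in \<nu>. norm (f x) \<le> B" using ae B by (auto elim: eventually_mono)
    show "f \<in> borel_measurable \<nu>"
      using borel_measurable_continuous_onI[OF f] s by (simp cong: measurable_cong_sets)
  qed
qed

text \<open>The zero alternative is for \<open>n = 0\<close>: the zero polynomial has degree 0,
  which is not below 0.\<close>

lemma degree_diff_less_or_eq_0:
  fixes p q :: "'a::comm_ring_1 poly"
  assumes "degree p \<le> n" "degree q \<le> n" "coeff p n = coeff q n"
  shows "p - q = 0 \<or> degree (p - q) < n"
proof -
  have "degree (p - q) \<le> n" using assms by (simp add: degree_diff_le)
  moreover have "coeff (p - q) n = 0" using assms by simp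
  ultimately show ?thesis by (metis le_neq_implies_less leading_coeff_0_iff)
qed

section \<open>Orthogonal polynomials on the unit circle\<close>

definition poly_ip :: "complex measure \<Rightarrow> complex poly \<Rightarrow> complex poly \<Rightarrow> complex" where
  "poly_ip \<sigma> p q = (\<integral>z. poly p z * cnj (poly q z) \<partial>\<sigma>)"

locale circle_measure =
  fixes \<sigma> :: "complex measure"
  assumes circle: "prob_measure_on (sphere 0 1) \<sigma>"
begin

abbreviation ip where "ip \<equiv> poly_ip \<sigma>"

lemma prob_space_circle: "prob_space \<sigma>"
  using circle by (simp add: prob_measure_on_def)

lemma AE_circle: "AE z in \<sigma>. norm z = 1"
  using circle by (auto simp: prob_measure_on_def)

text \<open>Lets z cnj z = 1 be used under the integral, although it fails off the circle;
  continuity supplies measurability.\<close>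

lemma integral_circle_cong:
  assumes "\<And>z. norm z = 1 \<Longrightarrow> f z = g z" "continuous_on UNIV f" "continuous_on UNIV g"
  shows "(\<integral>z. f z \<partial>\<sigma>) = (\<integral>z. g z \<partial>\<sigma> :: complex)"
proof (rule integral_cong_AE)
  have s: "sets \<sigma> = sets borel" using circle by (simp add: prob_measure_on_def)
  show "f \<in> borel_measurable \<sigma>" "g \<in> borel_measurable \<sigma>"
    using assms(2,3)[THEN borel_measurable_continuous_onI] s by (simp_all cong: measurable_cong_sets)
  show "AE z in \<sigma>. f z = g z" using AE_circle assms(1) by (auto elim: eventually_mono)
qed

lemma integrable_circle: "continuous_on UNIV f \<Longrightarrow> integrable \<sigma> (f :: complex \<Rightarrow> complex)"
  by (rule integrable_continuous_on_compact_support[OF circle]) auto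

lemma integrable_ip [simp]: "integrable \<sigma> (\<lambda>z. poly p z * cnj (poly q z))"
  by (intro integrable_circle continuous_intros)

lemma ip_cnj: "ip q p = cnj (ip p q)"
  unfolding poly_ip_def by (simp flip: Bochner_Integration.integral_cnj add: mult.commute)

lemma cnj_ip_self: "cnj (ip p p) = ip p p"
  by (rule ip_cnj[symmetric])

lemma ip_add_left: "ip (p + q) r = ip p r + ip q r"
  by (simp add: poly_ip_def ring_distribs)

lemma ip_diff_left: "ip (p - q) r = ip p r - ip q r"
  by (simp add: poly_ip_def ring_distribs)

lemma ip_smult_left: "ip (smult c p) r = c * ip p r"
  by (simp add: poly_ip_def mult.assoc)

lemma ip_add_right: "ip r (p + q) = ip r p + ip r q"
  by (simp add: poly_ip_def ring_distribs)

lemma ip_diff_right: "ip r (p - q) = ip r p - ip r q"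
  by (simp add: poly_ip_def ring_distribs)

lemma ip_smult_right: "ip r (smult c p) = cnj c * ip r p"
proof -
  have "ip r (smult c p) = cnj (ip (smult c p) r)" by (rule ip_cnj)
  also have "\<dots> = cnj c * cnj (ip p r)" by (simp add: ip_smult_left)
  also have "cnj (ip p r) = ip r p" by (rule ip_cnj[symmetric])
  finally show ?thesis .
qed

lemma ip_0_right [simp]: "ip p 0 = 0" by (simp add: poly_ip_def)

lemma ip_sum_right: "ip p (\<Sum>i\<in>A. f i) = (\<Sum>i\<in>A. ip p (f i))"
  by (induction A rule: infinite_finite_induct) (auto simp: ip_add_right)

lemma ip_eq_sum_coeff:
  assumes "degree q \<le> n"
  shows "ip p q = (\<Sum>j\<le>n. cnj (coeff q j) * ip p (monom 1 j))"
proof -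
  have "q = (\<Sum>j\<le>n. smult (coeff q j) (monom 1 j))"
    using poly_as_sum_of_monoms'[OF assms] by (simp add: smult_monom)
  then have "ip p q = ip p (\<Sum>j\<le>n. smult (coeff q j) (monom 1 j))" by simp
  then show ?thesis by (simp add: ip_sum_right ip_smult_right)
qed

lemma ip_eq_top_coeff:
  assumes "\<And>j. j < n \<Longrightarrow> ip p (monom 1 j) = 0" "degree q \<le> n"
  shows "ip p q = cnj (coeff q n) * ip p (monom 1 n)"
  unfolding ip_eq_sum_coeff[OF assms(2)] using assms(1) by (simp flip: lessThan_Suc_atMost)

text \<open>Asking only about exponents that occur in \<open>q\<close> lets missing end coefficients
  compensate for missing orthogonality to the end monomials.\<close>

lemma ip_eq_0I:
  assumes "\<And>j. coeff q j \<noteq> 0 \<Longrightarrow> ip p (monom 1 j) = 0"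
  shows "ip p q = 0"
  using assms by (subst ip_eq_sum_coeff[OF order_refl]) (intro sum.neutral, auto)

text \<open>Multiplication by z is an isometry because |z| = 1 on the circle.\<close>

lemma ip_shift: "ip (pCons 0 p) (pCons 0 q) = ip p q"
  unfolding poly_ip_def
proof (rule integral_circle_cong)
  fix z :: complex assume z: "norm z = 1"
  have "poly (pCons 0 p) z * cnj (poly (pCons 0 q) z) = (z * cnj z) * (poly p z * cnj (poly q z))"
    by (simp add: mult_ac)
  then show "poly (pCons 0 p) z * cnj (poly (pCons 0 q) z) = poly p z * cnj (poly q z)"
    using z by (simp add: complex_norm_square[symmetric])
qed (intro continuous_intros)+

lemma ip_self: "ip p p = of_real (\<integral>z. (norm (poly p z))\<^sup>2 \<partial>\<sigma>)"
  unfolding poly_ip_def complex_norm_square[symmetric] by (rule integral_complex_of_real)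

end

locale nontrivial_circle_measure = circle_measure +
  assumes nontrivial: "nontrivial_measure \<sigma>"
begin

text \<open>Otherwise the finite root set of \<open>p\<close> would carry the whole measure.\<close>

lemma ip_self_eq_0D:
  assumes "ip p p = 0" shows "p = 0"
proof (rule ccontr)
  assume "p \<noteq> 0"
  have int: "integrable \<sigma> (\<lambda>z. (norm (poly p z))\<^sup>2)"
    by (rule integrable_continuous_on_compact_support[OF circle]) (auto intro!: continuous_intros)
  have "(\<integral>z. (norm (poly p z))\<^sup>2 \<partial>\<sigma>) = 0" using assms by (simp add: ip_self)
  then have "AE z in \<sigma>. (norm (poly p z))\<^sup>2 = 0"
    using integral_nonneg_eq_0_iff_AE[OF int] by simp
  then have "AE z in \<sigma>. z \<in> {z. poly p z = 0}" by simp
  then show False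
    using nontrivial poly_roots_finite[OF \<open>p \<noteq> 0\<close>] by (auto simp: nontrivial_measure_def)
qed

text \<open>The Szego recursion for \<open>\<Phi>\<^sub>n\<close> and the reversed polynomial \<open>\<Phi>\<^sup>*\<^sub>n\<close>; the scalar is
  the conjugate of \<open>\<alpha>\<^sub>n\<close>, chosen so that \<open>\<Phi>\<^sub>n\<^sub>+\<^sub>1\<close> is orthogonal to 1.\<close>

primrec szego_pair :: "nat \<Rightarrow> complex poly \<times> complex poly" where
  "szego_pair 0 = (1, 1)"
| "szego_pair (Suc n) =
     (let p = fst (szego_pair n); q = snd (szego_pair n); c = ip (pCons 0 p) 1 / ip p p
      in (pCons 0 p - smult c q, q - smult (cnj c) (pCons 0 p)))"

definition \<Phi> where "\<Phi> n = fst (szego_pair n)"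
definition \<Phi>s where "\<Phi>s n = snd (szego_pair n)"
definition verb where "verb n = cnj (ip (pCons 0 (\<Phi> n)) 1 / ip (\<Phi> n) (\<Phi> n))"

lemma \<Phi>_0 [simp]: "\<Phi> 0 = 1" and \<Phi>s_0 [simp]: "\<Phi>s 0 = 1"
  by (simp_all add: \<Phi>_def \<Phi>s_def)

lemma \<Phi>_Suc: "\<Phi> (Suc n) = pCons 0 (\<Phi> n) - smult (cnj (verb n)) (\<Phi>s n)"
  and \<Phi>s_Suc: "\<Phi>s (Suc n) = \<Phi>s n - smult (verb n) (pCons 0 (\<Phi> n))"
  by (simp_all add: \<Phi>_def \<Phi>s_def verb_def Let_def)

lemma \<Phi>_degree_aux:
  "degree (\<Phi> n) \<le> n \<and> coeff (\<Phi> n) n = 1 \<and> degree (\<Phi>s n) \<le> n \<and> coeff (\<Phi>s n) 0 = 1"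
proof (induction n)
  case (Suc n)
  have 1: "degree (pCons 0 (\<Phi> n)) \<le> Suc n" using Suc by (simp add: degree_pCons_le order_trans[OF degree_pCons_le])
  have 2: "degree (\<Phi>s n) \<le> Suc n" using Suc by simp
  have 3: "coeff (\<Phi>s n) (Suc n) = 0" using Suc by (simp add: coeff_eq_0)
  show ?case
    using Suc 1 2 3 unfolding \<Phi>_Suc \<Phi>s_Suc
    by (auto intro!: degree_diff_le order_trans[OF degree_smult_le])
qed simp

lemma coeff_\<Phi>_top: "coeff (\<Phi> n) n = 1"
  and degree_\<Phi>s: "degree (\<Phi>s n) \<le> n"
  and coeff_\<Phi>s_0: "coeff (\<Phi>s n) 0 = 1"
  using \<Phi>_degree_aux by auto

lemma degree_\<Phi>: "degree (\<Phi> n) = n"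
  using \<Phi>_degree_aux[of n] by (intro antisym le_degree) auto

lemma \<Phi>_neq_0: "\<Phi> n \<noteq> 0"
  using coeff_\<Phi>_top[of n] by auto

lemma ip_\<Phi>_self_neq_0: "ip (\<Phi> n) (\<Phi> n) \<noteq> 0"
  using ip_self_eq_0D \<Phi>_neq_0 by blast

text \<open>Justifies calling \<open>\<Phi>s n\<close> the reversed polynomial. In the induction,
  powers of z cnj z = 1 are inserted to balance the degrees.\<close>

lemma poly_\<Phi>s: "norm z = 1 \<Longrightarrow> poly (\<Phi>s n) z = z ^ n * cnj (poly (\<Phi> n) z)"
proof (induction n)
  case (Suc n)
  have z: "z * cnj z = 1" using Suc.prems by (simp add: complex_norm_square[symmetric])
  have "poly (\<Phi>s (Suc n)) z = z ^ n * cnj (poly (\<Phi> n) z) - verb n * (z * poly (\<Phi> n) z)"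
    using Suc by (simp add: \<Phi>s_Suc)
  also have "\<dots> = z ^ n * (z * cnj z) * cnj (poly (\<Phi> n) z)
      - verb n * z * (z * cnj z) ^ n * poly (\<Phi> n) z"
    by (simp add: z)
  also have "\<dots> = z ^ Suc n * cnj (poly (\<Phi> (Suc n)) z)"
    using Suc by (simp add: \<Phi>_Suc algebra_simps power_mult_distrib)
  finally show ?case .
qed simp

text \<open>Reversal turns the exponent j into n - j, so orthogonality of \<open>\<Phi> n\<close> to
  1, ..., z^(n-1) becomes orthogonality of \<open>\<Phi>s n\<close> to z, ..., z^n.\<close>

lemma ip_\<Phi>s_monom:
  assumes "j \<le> n" shows "ip (\<Phi>s n) (monom 1 j) = ip (monom 1 (n - j)) (\<Phi> n)"
  unfolding poly_ip_def
proof (rule integral_circle_cong)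
  fix z :: complex assume "norm z = 1"
  then have z: "z * cnj z = 1" by (simp add: complex_norm_square[symmetric])
  have "z ^ n * cnj z ^ j = z ^ (n - j) * (z * cnj z) ^ j"
    using assms by (simp add: power_mult_distrib flip: power_add)
  then show "poly (\<Phi>s n) z * cnj (poly (monom 1 j) z)
      = poly (monom 1 (n - j)) z * cnj (poly (\<Phi> n) z)"
    using poly_\<Phi>s[OF \<open>norm z = 1\<close>, of n] z by (simp add: poly_monom mult_ac)
qed (intro continuous_intros)+

text \<open>For positive \<open>j\<close> both terms of the recursion are orthogonal to z^j, one by
  the shift and one by reversal. For \<open>j = 0\<close> the choice of \<open>verb\<close> cancels
  them.\<close>

lemma ip_\<Phi>_low: "j < n \<Longrightarrow> ip (\<Phi> n) (monom 1 j) = 0"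
proof (induction n arbitrary: j)
  case (Suc n)
  show ?case
  proof (cases j)
    case 0
    \<comment> \<open>This inner product is the squared norm of \<open>\<Phi> n\<close>, exactly the
      denominator in \<open>verb\<close>.\<close>
    have "ip (\<Phi>s n) 1 = ip (monom 1 n) (\<Phi> n)" using ip_\<Phi>s_monom[of 0 n] by simp
    also have "\<dots> = cnj (ip (\<Phi> n) (monom 1 n))" by (rule ip_cnj)
    also have "ip (\<Phi> n) (monom 1 n) = ip (\<Phi> n) (\<Phi> n)"
      using ip_eq_top_coeff[OF Suc.IH, where q = "\<Phi> n"] by (simp add: degree_\<Phi> coeff_\<Phi>_top)
    also have "cnj (ip (\<Phi> n) (\<Phi> n)) = ip (\<Phi> n) (\<Phi> n)" by (rule ip_cnj[symmetric])
    finally show ?thesis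
      using 0 ip_\<Phi>_self_neq_0[of n]
      by (simp add: \<Phi>_Suc ip_diff_left ip_smult_left verb_def)
  next
    case (Suc i)
    have "ip (pCons 0 (\<Phi> n)) (monom 1 (Suc i)) = 0"
      using Suc.IH Suc \<open>j < Suc n\<close> by (simp add: monom_Suc ip_shift)
    moreover have "ip (\<Phi>s n) (monom 1 (Suc i)) = 0"
      using Suc.IH Suc \<open>j < Suc n\<close> by (simp add: ip_\<Phi>s_monom ip_cnj[of "monom _ _"])
    ultimately show ?thesis using Suc by (simp add: \<Phi>_Suc ip_diff_left ip_smult_left)
  qed
qed simp

lemma ip_\<Phi>_eq_0:
  assumes "degree q < n" shows "ip (\<Phi> n) q = 0"
  by (rule ip_eq_0I, rule ip_\<Phi>_low) (use assms in \<open>auto dest: le_degree\<close>)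

lemma ip_\<Phi>s_low: "0 < j \<Longrightarrow> j \<le> n \<Longrightarrow> ip (\<Phi>s n) (monom 1 j) = 0"
  by (simp add: ip_\<Phi>s_monom ip_cnj[of "monom _ _"] ip_\<Phi>_low)

lemma ip_shift_\<Phi>_low: "0 < j \<Longrightarrow> j \<le> n \<Longrightarrow> ip (pCons 0 (\<Phi> n)) (monom 1 j) = 0"
  by (cases j) (auto simp: monom_Suc ip_shift ip_\<Phi>_low)

lemma ip_shift_\<Phi>_1: "ip (pCons 0 (\<Phi> n)) 1 = cnj (verb n) * ip (\<Phi> n) (\<Phi> n)"
  using ip_\<Phi>_self_neq_0[of n] by (simp add: verb_def)

text \<open>Since z times \<open>\<Phi> n\<close> is orthogonal to z, ..., z^n, only the constant
  term 1 of \<open>\<Phi>s n\<close> contributes.\<close>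

lemma ip_shift_\<Phi>_\<Phi>s: "ip (pCons 0 (\<Phi> n)) (\<Phi>s n) = cnj (verb n) * ip (\<Phi> n) (\<Phi> n)"
proof -
  have "ip (pCons 0 (\<Phi> n)) (\<Phi>s n) = (\<Sum>j\<le>n. cnj (coeff (\<Phi>s n) j) * ip (pCons 0 (\<Phi> n)) (monom 1 j))"
    by (rule ip_eq_sum_coeff[OF degree_\<Phi>s])
  also have "\<dots> = (\<Sum>j\<in>{0}. cnj (coeff (\<Phi>s n) j) * ip (pCons 0 (\<Phi> n)) (monom 1 j))"
    by (rule sum.mono_neutral_right) (auto simp: ip_shift_\<Phi>_low)
  finally show ?thesis by (simp add: coeff_\<Phi>s_0 ip_shift_\<Phi>_1)
qed

text \<open>As \<open>\<Phi>s n\<close> has degree at most n, it is orthogonal to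
  \<open>\<Phi> (Suc n)\<close>, so one factor may be replaced by z times
  \<open>\<Phi> n\<close>.\<close>

lemma norm_\<Phi>_Suc: "ip (\<Phi> (Suc n)) (\<Phi> (Suc n)) = (1 - verb n * cnj (verb n)) * ip (\<Phi> n) (\<Phi> n)"
proof -
  have "ip (\<Phi> (Suc n)) (\<Phi>s n) = 0" by (rule ip_\<Phi>_eq_0) (simp add: degree_\<Phi>s le_imp_less_Suc)
  then have "ip (\<Phi> (Suc n)) (\<Phi> (Suc n)) = ip (\<Phi> (Suc n)) (pCons 0 (\<Phi> n))"
    by (subst (2) \<Phi>_Suc) (simp add: ip_diff_right ip_smult_right)
  also have "\<dots> = ip (\<Phi> n) (\<Phi> n) - cnj (verb n) * cnj (ip (pCons 0 (\<Phi> n)) (\<Phi>s n))"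
    by (simp add: \<Phi>_Suc ip_diff_left ip_smult_left ip_shift ip_cnj[of "\<Phi>s n"])
  also have "\<dots> = (1 - verb n * cnj (verb n)) * ip (\<Phi> n) (\<Phi> n)"
    by (simp add: ip_shift_\<Phi>_\<Phi>s algebra_simps cnj_ip_self)
  finally show ?thesis .
qed

section \<open>Uniqueness of the monic orthogonal polynomials\<close>

lemma ip_monic_ops_eq_0:
  assumes P: "monic_ops_circle \<sigma> P" and "degree q < n"
  shows "ip (P n) q = 0"
  using \<open>degree q < n\<close>
proof (induction "degree q" arbitrary: q rule: less_induct)
  case less
  have deg: "degree (P (degree q)) = degree q" and lc: "coeff (P (degree q)) (degree q) = 1"
    using P unfolding monic_ops_circle_def by metis+
  have orth: "ip (P n) (P (degree q)) = 0"
    using P less.prems by (auto simp: monic_ops_circle_def poly_ip_def)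
  define r where "r = q - smult (lead_coeff q) (P (degree q))"
  have q: "q = r + smult (lead_coeff q) (P (degree q))" by (simp add: r_def)
  have r: "r = 0 \<or> degree r < degree q"
    unfolding r_def by (rule degree_diff_less_or_eq_0) (simp_all add: deg lc)
  have "ip (P n) r = 0"
  proof (cases "r = 0")
    case False
    then show ?thesis using r less by simp
  qed simp
  then show ?case by (subst q) (simp add: ip_add_right ip_smult_right orth)
qed

lemma monic_ops_circle_\<Phi>: "monic_ops_circle \<sigma> \<Phi>"
proof -
  have 1: "ip (\<Phi> m) (\<Phi> n) = 0" if "n < m" for m n
    using that by (intro ip_\<Phi>_eq_0) (simp add: degree_\<Phi>)
  have "ip (\<Phi> m) (\<Phi> n) = 0" if "m \<noteq> n" for m n
    using that
  proof (cases m n rule: linorder_cases)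
    case less
    then show ?thesis by (subst ip_cnj) (simp add: 1)
  qed (auto simp: 1)
  then show ?thesis by (auto simp: monic_ops_circle_def degree_\<Phi> coeff_\<Phi>_top poly_ip_def)
qed

text \<open>Resolves the definite description: two monic candidates of degree n differ by a
  polynomial of smaller degree, which is then orthogonal to itself.\<close>

lemma monic_opuc_eq: "monic_opuc \<sigma> = \<Phi>"
  unfolding monic_opuc_def
proof (rule the_equality)
  show "monic_ops_circle \<sigma> \<Phi>" by (rule monic_ops_circle_\<Phi>)
next
  fix P assume P: "monic_ops_circle \<sigma> P"
  show "P = \<Phi>"
  proof
    fix n
    define D where "D = P n - \<Phi> n"
    show "P n = \<Phi> n"
    proof (rule ccontr)
      assume "P n \<noteq> \<Phi> n"
      then have "D \<noteq> 0" by (simp add: D_def)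
      moreover have "degree (P n) = n" "coeff (P n) n = 1"
        using P unfolding monic_ops_circle_def by metis+
      ultimately have "degree D < n"
        using degree_diff_less_or_eq_0[of "P n" n "\<Phi> n"]
        by (simp add: D_def degree_\<Phi> coeff_\<Phi>_top)
      then have "ip D D = 0"
        using ip_monic_ops_eq_0[OF P] ip_\<Phi>_eq_0 by (subst (1) D_def) (simp add: ip_diff_left)
      then show False using ip_self_eq_0D \<open>D \<noteq> 0\<close> by blast
    qed
  qed
qed

lemma coeff_\<Phi>_Suc_0: "coeff (\<Phi> (Suc n)) 0 = - cnj (verb n)"
  by (simp add: \<Phi>_Suc coeff_\<Phi>s_0)

lemma verblunsky_eq: "verblunsky \<sigma> (int n) = verb n"
proof -
  have "nat (int n + 1) = Suc n" by simp
  then show ?thesis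
    by (simp add: verblunsky_def monic_opuc_eq poly_0_coeff_0 coeff_\<Phi>_Suc_0)
qed

end


section \<open>Orthogonal polynomials on the interval\<close>

text \<open>The witness is the Chebyshev polynomial, built from T_(n+2) = 2 x T_(n+1) - T_n.\<close>

lemma chebyshev_poly_exists:
  "\<exists>T :: real poly. degree T \<le> n \<and> (\<forall>z. norm z = 1 \<longrightarrow> Re (z ^ n) = poly T (Re z))"
proof (induction n rule: less_induct)
  case (less n)
  consider "n = 0" | "n = 1" | i where "n = Suc (Suc i)" by (metis One_nat_def not0_implies_Suc)
  then show ?case
  proof cases
    case 1
    then show ?thesis by (intro exI[of _ 1]) simp
  next
    case 2
    then show ?thesis by (intro exI[of _ "[:0, 1:]"]) simp
  next
    case 3
    obtain S where S: "degree S \<le> i" "\<And>z. norm z = 1 \<Longrightarrow> Re (z ^ i) = poly S (Re z)"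
      using less[of i] 3 by auto
    obtain T where T: "degree T \<le> Suc i" "\<And>z. norm z = 1 \<Longrightarrow> Re (z ^ Suc i) = poly T (Re z)"
      using less[of "Suc i"] 3 by auto
    have "Re (z ^ n) = poly (smult 2 (pCons 0 T) - S) (Re z)" if "norm z = 1" for z
    proof -
      have z: "z * cnj z = 1" using that by (simp add: complex_norm_square[symmetric])
      have "z ^ n + z ^ i = z ^ n + (z * cnj z) * z ^ i" by (simp add: z)
      also have "\<dots> = z ^ Suc i * (z + cnj z)" using 3 by (simp add: algebra_simps)
      also have "\<dots> = of_real (2 * Re z) * z ^ Suc i" by (simp add: complex_add_cnj mult_ac)
      finally have "Re (z ^ n + z ^ i) = Re (of_real (2 * Re z) * z ^ Suc i)" by (rule arg_cong)
      then have "Re (z ^ n) + Re (z ^ i) = 2 * Re z * Re (z ^ Suc i)"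
        by (simp only: plus_complex.sel times_complex.sel Re_complex_of_real Im_complex_of_real)
      then show ?thesis by (simp only: S(2)[OF that] T(2)[OF that]) simp
    qed
    moreover have "degree (smult 2 (pCons 0 T) - S) \<le> n"
      using S(1) T(1) 3 by (auto intro!: degree_diff_le order_trans[OF degree_pCons_le])
    ultimately show ?thesis by blast
  qed
qed

locale jacobi_measure =
  fixes \<nu> :: "real measure" and b d :: "nat \<Rightarrow> real"
  assumes line: "prob_measure_on {-1..1} \<nu>"
    and ops: "monic_ops_line \<nu> (three_term_poly b d)"
    and d_pos: "\<And>n. n \<ge> 1 \<Longrightarrow> 0 < d n"
begin

abbreviation P where "P \<equiv> three_term_poly b d"

lemma degree_P: "degree (P n) = n" and coeff_P_top: "coeff (P n) n = 1"
  using ops unfolding monic_ops_line_def by metis+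

lemma integrable_poly_line [simp]:
  "integrable \<nu> (\<lambda>x. poly p x)" "integrable \<nu> (\<lambda>x. poly p x * poly q x)"
  by (rule integrable_continuous_on_compact_support[OF line]; auto intro!: continuous_intros)+

lemma integral_P_mult_eq_0:
  assumes "q = 0 \<or> degree q < n"
  shows "(\<integral>x. poly (P n) x * poly q x \<partial>\<nu>) = 0"
  using assms
proof (induction "degree q" arbitrary: q rule: less_induct)
  case less
  show ?case
  proof (cases "q = 0")
    case False
    define s where "s = smult (lead_coeff q) (P (degree q))"
    have orth: "(\<integral>x. poly (P n) x * poly (P (degree q)) x \<partial>\<nu>) = 0"
      using ops less.prems False by (auto simp: monic_ops_line_def)
    have r: "q - s = 0 \<or> degree (q - s) < degree q"
      by (rule degree_diff_less_or_eq_0) (simp_all add: s_def degree_P coeff_P_top)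
    have "(\<integral>x. poly (P n) x * poly (q - s) x \<partial>\<nu>) = 0"
    proof (cases "q - s = 0")
      case False
      with r less.prems \<open>q \<noteq> 0\<close> show ?thesis by (intro less.hyps) auto
    qed simp
    moreover have "(\<integral>x. poly (P n) x * poly s x \<partial>\<nu>) = 0"
      using orth by (simp add: s_def mult.left_commute)
    moreover have "(\<integral>x. poly (P n) x * poly q x \<partial>\<nu>) =
        (\<integral>x. poly (P n) x * poly (q - s) x + poly (P n) x * poly s x \<partial>\<nu>)"
      by (simp add: algebra_simps)
    ultimately show ?thesis by (simp del: poly_diff)
  qed simp
qed

definition h where "h n = (\<integral>x. poly (P n) x * poly (P n) x \<partial>\<nu>)"

text \<open>Lower-order terms of \<open>q\<close> are invisible to \<open>P n\<close>.\<close>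

lemma integral_P_mult_monic:
  assumes "degree q \<le> n" "coeff q n = 1"
  shows "(\<integral>x. poly (P n) x * poly q x \<partial>\<nu>) = h n"
proof -
  have "q - P n = 0 \<or> degree (q - P n) < n"
    using assms by (intro degree_diff_less_or_eq_0) (simp_all add: degree_P coeff_P_top)
  then have "(\<integral>x. poly (P n) x * poly (q - P n) x \<partial>\<nu>) = 0" by (rule integral_P_mult_eq_0)
  then show ?thesis by (simp add: h_def right_diff_distrib)
qed

lemma h_0: "h 0 = 1"
proof -
  interpret prob_space \<nu> using line by (simp add: prob_measure_on_def)
  show ?thesis by (simp add: h_def prob_space)
qed

lemma h_Suc: "h (Suc n) = d (Suc n) * h n"
proof -
  \<comment> \<open>One factor P_(n+1) is traded for x P_n; then x is moved to the other factor,
    where the three-term recurrence expands x P_(n+1).\<close>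
  have "h (Suc n) = (\<integral>x. poly (P (Suc n)) x * poly (pCons 0 (P n)) x \<partial>\<nu>)"
    by (rule integral_P_mult_monic[symmetric]) (auto simp: coeff_P_top degree_P intro: order_trans[OF degree_pCons_le])
  also have "\<dots> = (\<integral>x. poly (P n) x * poly (P (Suc (Suc n))) x
      + b (n + 2) * (poly (P n) x * poly (P (Suc n)) x)
      + d (Suc n) * (poly (P n) x * poly (P n) x) \<partial>\<nu>)"
    by (intro Bochner_Integration.integral_cong refl) (simp add: algebra_simps)
  also have "\<dots> = (\<integral>x. poly (P n) x * poly (P (Suc (Suc n))) x \<partial>\<nu>)
      + b (n + 2) * (\<integral>x. poly (P n) x * poly (P (Suc n)) x \<partial>\<nu>)
      + d (Suc n) * h n"
    by (simp del: three_term_poly.simps add: h_def)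
  also have "(\<integral>x. poly (P n) x * poly (P (Suc (Suc n))) x \<partial>\<nu>) = 0"
    using ops unfolding monic_ops_line_def by (metis n_not_Suc_n less_SucI lessI less_irrefl)
  also have "(\<integral>x. poly (P n) x * poly (P (Suc n)) x \<partial>\<nu>) = 0"
    using ops unfolding monic_ops_line_def by (metis n_not_Suc_n)
  finally show ?thesis by simp
qed

lemma h_pos: "0 < h n"
  by (induction n) (simp_all add: h_0 h_Suc d_pos)

text \<open>If a finite \<open>F\<close> carried the measure, the monic polynomial with roots
  \<open>F\<close> would vanish almost everywhere, yet its integral against
  \<open>P (card F)\<close> is the positive number \<open>h (card F)\<close>.\<close>

lemma nontrivial_line: "nontrivial_measure \<nu>"
  unfolding nontrivial_measure_def
proof safe
  fix F :: "real set" assume F: "finite F" "AE x in \<nu>. x \<in> F"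
  define q where "q = (\<Prod>a\<in>F. [:- a, 1:])"
  have deg: "degree q = card F" unfolding q_def by (subst degree_prod_sum_eq) auto
  have "lead_coeff q = 1" by (simp add: q_def lead_coeff_prod)
  then have "(\<integral>x. poly (P (card F)) x * poly q x \<partial>\<nu>) = h (card F)"
    using deg by (intro integral_P_mult_monic) auto
  moreover have "(\<integral>x. poly (P (card F)) x * poly q x \<partial>\<nu>) = 0"
  proof (rule integral_eq_zero_AE)
    show "AE x in \<nu>. poly (P (card F)) x * poly q x = 0"
      using F by (auto simp: q_def poly_prod elim!: eventually_mono)
  qed
  ultimately show False using h_pos[of "card F"] by simp
qed

text \<open>The real part maps \<open>Sz \<nu>\<close> back to \<open>\<nu>\<close> and finite sets
  to finite sets.\<close>

lemma nontrivial_Sz: "nontrivial_measure (Sz \<nu>)"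
  unfolding nontrivial_measure_def
proof safe
  fix F assume F: "finite F" "AE z in Sz \<nu>. z \<in> F"
  have s: "sets (Sz \<nu>) = sets borel" by (simp add: Sz_def)
  have "AE x in distr (Sz \<nu>) borel Re. x \<in> Re ` F"
  proof (subst AE_distr_iff)
    show "Re \<in> measurable (Sz \<nu>) borel" using s by (simp cong: measurable_cong_sets)
    show "{x \<in> space borel. x \<in> Re ` F} \<in> sets borel"
      using F(1) by (simp add: finite_imp_closed borel_closed)
    show "AE z in Sz \<nu>. Re z \<in> Re ` F" using F(2) by (auto elim: eventually_mono)
  qed
  then have "AE x in \<nu>. x \<in> Re ` F" unfolding distr_Re_Sz[OF line] .
  then show False using nontrivial_line F(1) by (auto simp: nontrivial_measure_def)
qed

end

section \<open>The Szego transformation\<close>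

sublocale jacobi_measure \<subseteq> nontrivial_circle_measure "Sz \<nu>"
  using prob_measure_on_Sz[OF line] nontrivial_Sz by unfold_locales

context jacobi_measure
begin

section \<open>Conjugation symmetry and real Verblunsky coefficients\<close>

lemma integral_Sz_cnj:
  fixes f :: "complex \<Rightarrow> complex"
  assumes "continuous_on UNIV f"
  shows "(\<integral>z. f (cnj z) \<partial>Sz \<nu>) = (\<integral>z. f z \<partial>Sz \<nu>)"
proof -
  have s: "sets (Sz \<nu>) = sets borel" by (simp add: Sz_def)
  have c: "cnj \<in> borel_measurable borel" by (intro borel_measurable_continuous_onI continuous_intros)
  have "(\<integral>z. f z \<partial>distr (Sz \<nu>) borel cnj) = (\<integral>z. f (cnj z) \<partial>Sz \<nu>)"
    using c s borel_measurable_continuous_onI[OF assms]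
    by (intro integral_distr) (simp_all cong: measurable_cong_sets)
  then show ?thesis by (simp add: distr_cnj_Sz[OF line])
qed

lemma integral_Sz_Re:
  fixes f :: "real \<Rightarrow> complex"
  assumes "continuous_on UNIV f"
  shows "(\<integral>z. f (Re z) \<partial>Sz \<nu>) = (\<integral>x. f x \<partial>\<nu>)"
proof -
  have s: "sets (Sz \<nu>) = sets borel" by (simp add: Sz_def)
  have "(\<integral>x. f x \<partial>distr (Sz \<nu>) borel Re) = (\<integral>z. f (Re z) \<partial>Sz \<nu>)"
    using s borel_measurable_continuous_onI[OF assms]
    by (intro integral_distr) (simp_all cong: measurable_cong_sets)
  then show ?thesis by (simp add: distr_Re_Sz[OF line])
qed

text \<open>Invariance of the measure under conjugation swaps the two arguments, so the inner
  product equals its own conjugate.\<close>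

lemma ip_real:
  assumes "\<And>z. poly p (cnj z) = cnj (poly p z)" "\<And>z. poly q (cnj z) = cnj (poly q z)"
  shows "ip p q \<in> \<real>"
proof -
  have "ip p q = (\<integral>z. poly p (cnj z) * cnj (poly q (cnj z)) \<partial>Sz \<nu>)"
    unfolding poly_ip_def by (rule integral_Sz_cnj[symmetric]) (intro continuous_intros)
  also have "\<dots> = ip q p" by (simp add: poly_ip_def assms mult.commute)
  also have "\<dots> = cnj (ip p q)" by (rule ip_cnj)
  finally show ?thesis by (simp add: Reals_cnj_iff)
qed

text \<open>Commuting with conjugation expresses that the coefficients are real. The claims are
  proved jointly: real polynomials give a real \<open>verb n\<close>, which gives real polynomials
  at the next step.\<close>

lemma poly_\<Phi>_cnj:
  "(\<forall>z. poly (\<Phi> n) (cnj z) = cnj (poly (\<Phi> n) z)) \<and> (\<forall>z. poly (\<Phi>s n) (cnj z) = cnj (poly (\<Phi>s n) z))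
    \<and> cnj (verb n) = verb n"
proof (induction n)
  case 0
  have "ip [:0, 1:] 1 \<in> \<real>" "ip 1 1 \<in> \<real>" by (rule ip_real; simp)+
  then show ?case by (simp add: verb_def Reals_cnj_iff one_pCons[symmetric] )
next
  case (Suc n)
  then have 1: "poly (\<Phi> (Suc n)) (cnj z) = cnj (poly (\<Phi> (Suc n)) z)"
    "poly (\<Phi>s (Suc n)) (cnj z) = cnj (poly (\<Phi>s (Suc n)) z)" for z
    by (simp_all add: \<Phi>_Suc \<Phi>s_Suc)
  have "ip (pCons 0 (\<Phi> (Suc n))) 1 \<in> \<real>" "ip (\<Phi> (Suc n)) (\<Phi> (Suc n)) \<in> \<real>"
    by (rule ip_real; simp add: 1)+
  then show ?case using 1 by (simp add: verb_def Reals_cnj_iff)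
qed

definition v where "v n = Re (verb n)"

lemma verb_eq: "verb n = of_real (v n)"
  using poly_\<Phi>_cnj[of n] by (simp add: v_def complex_eq_iff)

definition N where "N n = Re (ip (\<Phi> n) (\<Phi> n))"

lemma ip_\<Phi>_self: "ip (\<Phi> n) (\<Phi> n) = of_real (N n)"
  by (simp add: N_def ip_self)

lemma N_pos: "0 < N n"
proof -
  have "0 \<le> N n" by (simp add: N_def ip_self)
  moreover have "N n \<noteq> 0" using ip_\<Phi>_self_neq_0[of n] by (simp add: ip_\<Phi>_self)
  ultimately show ?thesis by simp
qed

lemma N_Suc: "N (Suc n) = (1 - (v n)\<^sup>2) * N n"
proof -
  have "of_real (N (Suc n)) = (of_real ((1 - (v n)\<^sup>2) * N n) :: complex)"
    using norm_\<Phi>_Suc[of n] unfolding ip_\<Phi>_self verb_eq by (simp add: power2_eq_square)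
  then show ?thesis by (simp only: of_real_eq_iff)
qed

lemma N_0: "N 0 = 1"
proof -
  interpret prob_space "Sz \<nu>" by (rule prob_space_circle)
  show ?thesis by (simp add: N_def poly_ip_def prob_space)
qed

text \<open>The factor in \<open>N_Suc\<close> is a ratio of positive norms. This keeps the later
  denominators nonzero.\<close>

lemma v_square_less_1: "(v n)\<^sup>2 < 1"
  using N_Suc[of n] N_pos[of n] N_pos[of "Suc n"] by (simp add: zero_less_mult_iff)

lemma v_neq_1: "v n \<noteq> 1"
  using v_square_less_1[of n] by auto

section \<open>The lifted line polynomials and their orthogonality\<close>

text \<open>The polynomial that agrees with \<open>(2 z)\<^sup>n P\<^sub>n (Re z)\<close> on the unit circle: there
  \<open>2 z Re z = z\<^sup>2 + 1\<close>, which turns the recurrence for \<open>P\<^sub>n\<close> into the one below.\<close>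

fun lift :: "nat \<Rightarrow> complex poly" where
  "lift 0 = 1"
| "lift (Suc 0) = [:1, - 2 * of_real (b 1), 1:]"
| "lift (Suc (Suc n)) = lift (Suc n) + pCons 0 (smult (- 2 * of_real (b (n + 2))) (lift (Suc n)))
     + pCons 0 (pCons 0 (lift (Suc n) - smult (4 * of_real (d (n + 1))) (lift n)))"

lemma poly_lift:
  assumes "norm z = 1"
  shows "poly (lift n) z = (2 * z) ^ n * of_real (poly (P n) (Re z))"
proof -
  have "z * cnj z = 1" using assms by (simp add: complex_norm_square[symmetric])
  then have "z * (z + cnj z) = z * z + 1" by (simp add: algebra_simps)
  then have z: "1 + z * z = 2 * z * of_real (Re z)" by (simp add: complex_add_cnj mult_ac)
  show ?thesis
  proof (induction n rule: lift.induct)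
    case 2
    have "poly (lift (Suc 0)) z = (1 + z * z) - 2 * of_real (b 1) * z" by (simp add: algebra_simps)
    then show ?case unfolding z by (simp add: algebra_simps)
  next
    case (3 n)
    have "poly (lift (Suc (Suc n))) z = (1 + z * z - 2 * of_real (b (n + 2)) * z) * poly (lift (Suc n)) z
        - 4 * of_real (d (n + 1)) * z * z * poly (lift n) z" by (simp add: algebra_simps)
    also have "\<dots> = (2 * z) ^ Suc (Suc n) * of_real (poly (P (Suc (Suc n))) (Re z))"
      unfolding z 3 by (simp add: algebra_simps)
    finally show ?case .
  qed simp
qed

text \<open>Both end coefficients are tracked because they must cancel against those of the Szego
  side in \<open>lift_eq\<close>.\<close>

lemma lift_aux: "degree (lift n) \<le> 2 * n \<and> coeff (lift n) (2 * n) = 1 \<and> coeff (lift n) 0 = 1"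
proof (induction n rule: lift.induct)
  case 2
  show ?case by (simp add: numeral_2_eq_2)
next
  case (3 n)
  have e: "2 * Suc (Suc n) = 2 * n + 4" by simp
  have 1: "coeff (lift (Suc n)) (2 * n + 4) = 0" "coeff (lift (Suc n)) (2 * n + 3) = 0"
    "coeff (lift n) (2 * n + 2) = 0"
    using 3 by (simp_all add: coeff_eq_0)
  have 2: "degree (pCons 0 (smult c (lift (Suc n)))) \<le> 2 * n + 4" for c
    using 3(1) by (intro order_trans[OF degree_pCons_le]) (auto intro: order_trans[OF degree_smult_le])
  have "degree (lift (Suc n) - smult c (lift n)) \<le> 2 * n + 2" for c
    using 3 by (intro degree_diff_le) (auto intro: order_trans[OF degree_smult_le])
  then have 4: "degree (pCons 0 (pCons 0 (lift (Suc n) - smult c (lift n)))) \<le> 2 * n + 4" for c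
    by (simp add: order_trans[OF degree_pCons_le])
  have "degree (lift (Suc (Suc n))) \<le> 2 * n + 4"
    unfolding lift.simps using 2 4 3 by (intro degree_add_le) auto
  moreover have "coeff (lift (Suc (Suc n))) (2 * n + 4) = 1"
    using 1 3 by (simp add: coeff_pCons numeral_eq_Suc)
  moreover have "coeff (lift (Suc (Suc n))) 0 = 1" using 3 by simp
  ultimately show ?case unfolding e by blast
qed simp

lemma coeff_lift_1: "coeff (lift (Suc n)) 1 = coeff (lift n) 1 - 2 * of_real (b (Suc n))"
  using lift_aux by (cases n) (simp_all add: coeff_pCons)

text \<open>The two integrals agree by symmetry. Their sum involves z^i + cnj z^i = 2 T_i(Re z),
  hence is an integral over the line of \<open>P n\<close> against a polynomial of degree below
  \<open>n\<close>.\<close>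

lemma integral_P_Re_power:
  assumes "i < n"
  shows "(\<integral>z. of_real (poly (P n) (Re z)) * z ^ i \<partial>Sz \<nu>) = 0" (is "?I = 0")
    and "(\<integral>z. of_real (poly (P n) (Re z)) * cnj z ^ i \<partial>Sz \<nu>) = 0" (is "?J = 0")
proof -
  obtain T where T: "degree T \<le> i" "\<And>z. norm z = 1 \<Longrightarrow> Re (z ^ i) = poly T (Re z)"
    using chebyshev_poly_exists[of i] by auto
  have J: "?J = ?I"
    using integral_Sz_cnj[of "\<lambda>z. of_real (poly (P n) (Re z)) * z ^ i"] by (simp add: continuous_intros)
  have "?I + ?J = (\<integral>z. of_real (poly (P n) (Re z)) * z ^ i + of_real (poly (P n) (Re z)) * cnj z ^ i \<partial>Sz \<nu>)"
    by (rule Bochner_Integration.integral_add[symmetric]; intro integrable_circle continuous_intros)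
  also have "\<dots> = (\<integral>z. of_real (2 * (poly (P n) (Re z) * poly T (Re z))) \<partial>Sz \<nu>)"
  proof (rule integral_circle_cong)
    fix z :: complex assume z: "norm z = 1"
    have "z ^ i + cnj z ^ i = of_real (2 * poly T (Re z))"
      using complex_add_cnj[of "z ^ i"] by (simp add: T(2)[OF z])
    then show "of_real (poly (P n) (Re z)) * z ^ i + of_real (poly (P n) (Re z)) * cnj z ^ i
        = of_real (2 * (poly (P n) (Re z) * poly T (Re z)))"
      by (simp flip: distrib_left)
  qed (intro continuous_intros)+
  also have "\<dots> = (\<integral>x. of_real (2 * (poly (P n) x * poly T x)) \<partial>\<nu>)"
    by (rule integral_Sz_Re) (intro continuous_intros)
  also have "\<dots> = of_real (2 * (\<integral>x. poly (P n) x * poly T x \<partial>\<nu>))"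
    unfolding integral_complex_of_real by simp
  also have "(\<integral>x. poly (P n) x * poly T x \<partial>\<nu>) = 0"
    using T(1) assms by (intro integral_P_mult_eq_0) auto
  finally show "?I = 0" "?J = 0" using J by auto
qed

text \<open>On the circle z^n cnj z^j is a power of z or of cnj z with exponent |n - j|, which is
  below n in this range of j.\<close>

lemma ip_lift_monom:
  assumes "0 < j" "j < 2 * n"
  shows "ip (lift n) (monom 1 j) = 0"
proof (cases "j \<le> n")
  case True
  have "ip (lift n) (monom 1 j) = (\<integral>z. 2 ^ n * (of_real (poly (P n) (Re z)) * z ^ (n - j)) \<partial>Sz \<nu>)"
    unfolding poly_ip_def
  proof (rule integral_circle_cong)
    fix z :: complex assume "norm z = 1"
    then have z: "z * cnj z = 1" by (simp add: complex_norm_square[symmetric])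
    have "z ^ n * cnj z ^ j = z ^ (n - j) * (z * cnj z) ^ j"
      using True by (simp add: power_mult_distrib flip: power_add)
    then show "poly (lift n) z * cnj (poly (monom 1 j) z)
        = 2 ^ n * (of_real (poly (P n) (Re z)) * z ^ (n - j))"
      using poly_lift[OF \<open>norm z = 1\<close>, of n] z by (simp add: poly_monom mult_ac power_mult_distrib)
  qed (intro continuous_intros)+
  then show ?thesis using integral_P_Re_power(1)[of "n - j" n] assms by simp
next
  case False
  have "ip (lift n) (monom 1 j) = (\<integral>z. 2 ^ n * (of_real (poly (P n) (Re z)) * cnj z ^ (j - n)) \<partial>Sz \<nu>)"
    unfolding poly_ip_def
  proof (rule integral_circle_cong)
    fix z :: complex assume "norm z = 1"
    then have z: "z * cnj z = 1" by (simp add: complex_norm_square[symmetric])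
    have "z ^ n * cnj z ^ j = cnj z ^ (j - n) * (z * cnj z) ^ n"
      using False by (simp add: power_mult_distrib mult_ac flip: power_add)
    then show "poly (lift n) z * cnj (poly (monom 1 j) z)
        = 2 ^ n * (of_real (poly (P n) (Re z)) * cnj z ^ (j - n))"
      using poly_lift[OF \<open>norm z = 1\<close>, of n] z by (simp add: poly_monom mult_ac power_mult_distrib)
  qed (intro continuous_intros)+
  then show ?thesis using integral_P_Re_power(2)[of "j - n" n] assms False by simp
qed

lemma ip_lift_self: "ip (lift n) (lift n) = of_real (4 ^ n * h n)"
proof -
  have "ip (lift n) (lift n) = (\<integral>z. of_real (4 ^ n * (poly (P n) (Re z) * poly (P n) (Re z))) \<partial>Sz \<nu>)"
    unfolding poly_ip_def
  proof (rule integral_circle_cong)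
    fix z :: complex assume "norm z = 1"
    then have z: "z * cnj z = 1" by (simp add: complex_norm_square[symmetric])
    have "(2 * z) ^ n * cnj ((2 * z) ^ n) = (4 * (z * cnj z)) ^ n"
      by (simp add: power_mult_distrib flip: power_mult_distrib[of 2 2])
    then have "(2 * z) ^ n * cnj ((2 * z) ^ n) = 4 ^ n" by (simp add: z)
    then show "poly (lift n) z * cnj (poly (lift n) z)
        = of_real (4 ^ n * (poly (P n) (Re z) * poly (P n) (Re z)))"
      unfolding poly_lift[OF \<open>norm z = 1\<close>] by (simp add: mult_ac)
  qed (intro continuous_intros)+
  also have "\<dots> = (\<integral>x. of_real (4 ^ n * (poly (P n) x * poly (P n) x)) \<partial>\<nu>)"
    by (rule integral_Sz_Re) (intro continuous_intros)
  also have "\<dots> = of_real (4 ^ n * h n)"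
    unfolding integral_complex_of_real h_def by simp
  finally show ?thesis .
qed

lemma lift_eq: "lift (Suc m) = pCons 0 (\<Phi> (2 * m + 1)) + \<Phi>s (2 * m + 1)" (is "_ = ?R")
proof -
  let ?n = "2 * m + 1"
  define D where "D = lift (Suc m) - ?R"
  have R: "degree ?R \<le> 2 * Suc m"
    using degree_\<Phi>s[of ?n] degree_\<Phi>[of ?n]
    by (intro degree_add_le order_trans[OF degree_pCons_le]) auto
  have "coeff (\<Phi>s ?n) (2 * Suc m) = 0" using degree_\<Phi>s[of ?n] by (intro coeff_eq_0) simp
  then have top: "coeff ?R (2 * Suc m) = 1" using coeff_\<Phi>_top[of ?n] by (simp add: coeff_pCons)
  have D: "D = 0 \<or> degree D < 2 * Suc m"
    unfolding D_def using R top lift_aux[of "Suc m"] by (intro degree_diff_less_or_eq_0) auto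
  have D0: "coeff D 0 = 0" using lift_aux[of "Suc m"] by (simp add: D_def coeff_\<Phi>s_0)
  \<comment> \<open>\<open>D\<close> has lost its top and constant terms, so only z, ..., z^(2m+1)
    occur in it, and \<open>D\<close> is orthogonal to all of these.\<close>
  have "ip D D = 0"
  proof (rule ip_eq_0I)
    fix j assume j: "coeff D j \<noteq> 0"
    then have "0 < j" using D0 by (metis gr0I)
    moreover have "j < 2 * Suc m" using j D le_degree[OF j] by auto
    ultimately show "ip D (monom 1 j) = 0"
      using ip_lift_monom[of j "Suc m"] ip_shift_\<Phi>_low[of j ?n] ip_\<Phi>s_low[of j ?n]
      by (simp add: D_def ip_diff_left ip_add_left)
  qed
  then have "D = 0" by (rule ip_self_eq_0D)
  then show ?thesis by (simp add: D_def)
qed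

text \<open>Expanding the norm of \<open>lift_eq\<close>: the two squares are equal because reversal
  preserves the modulus on the circle, and each cross term contributes \<open>v (2 * m + 1)\<close>
  times the norm.\<close>

lemma h_eq_N: "4 ^ Suc m * h (Suc m) = 2 * (1 + v (2 * m + 1)) * N (2 * m + 1)"
proof -
  let ?n = "2 * m + 1"
  have s: "ip (\<Phi>s ?n) (\<Phi>s ?n) = ip (\<Phi> ?n) (\<Phi> ?n)"
    unfolding poly_ip_def
  proof (rule integral_circle_cong)
    fix z :: complex assume "norm z = 1"
    then have z: "z * cnj z = 1" by (simp add: complex_norm_square[symmetric])
    then have "z ^ ?n * cnj z ^ ?n = 1" by (simp flip: power_mult_distrib del: power_Suc)
    then show "poly (\<Phi>s ?n) z * cnj (poly (\<Phi>s ?n) z) = poly (\<Phi> ?n) z * cnj (poly (\<Phi> ?n) z)"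
      unfolding poly_\<Phi>s[OF \<open>norm z = 1\<close>] by (simp add: mult_ac del: power_Suc)
  qed (intro continuous_intros)+
  have "of_real (4 ^ Suc m * h (Suc m)) = ip (lift (Suc m)) (lift (Suc m))" by (rule ip_lift_self[symmetric])
  also have "\<dots> = ip (\<Phi> ?n) (\<Phi> ?n) + ip (\<Phi>s ?n) (\<Phi>s ?n)
      + ip (pCons 0 (\<Phi> ?n)) (\<Phi>s ?n) + cnj (ip (pCons 0 (\<Phi> ?n)) (\<Phi>s ?n))"
    unfolding lift_eq ip_add_left ip_add_right ip_shift ip_cnj[of "\<Phi>s ?n" "pCons _ _"] by simp
  also have "\<dots> = of_real (2 * (1 + v ?n) * N ?n)"
    unfolding s ip_shift_\<Phi>_\<Phi>s ip_\<Phi>_self verb_eq by (simp add: algebra_simps)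
  finally show ?thesis by (simp only: of_real_eq_iff)
qed

section \<open>The Geronimus relations\<close>

lemma geronimus_d_0: "4 * d 1 = 2 * (1 - (v 0)\<^sup>2) * (1 + v 1)"
  using h_eq_N[of 0] h_Suc[of 0] N_Suc[of 0] by (simp add: h_0 N_0 algebra_simps)

text \<open>Quotient of two consecutive instances of \<open>h_eq_N\<close>. Of 1 - v^2 at index
  2m+1, the factor 1 + v is absorbed by \<open>?H\<close>, leaving 1 - v.\<close>

lemma geronimus_d_Suc:
  "4 * d (Suc (Suc m)) = (1 - v (2 * m + 1)) * (1 - (v (2 * m + 2))\<^sup>2) * (1 + v (2 * m + 3))"
proof -
  let ?H = "4 ^ Suc m * h (Suc m)"
  have N: "N (2 * m + 3) = (1 - (v (2 * m + 2))\<^sup>2) * ((1 - (v (2 * m + 1))\<^sup>2) * N (2 * m + 1))"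
    using N_Suc[of "2 * m + 1"] N_Suc[of "2 * m + 2"] by (simp add: numeral_3_eq_3)
  have "4 * d (Suc (Suc m)) * ?H = 4 ^ Suc (Suc m) * h (Suc (Suc m))"
    by (simp add: h_Suc[of "Suc m"])
  also have "\<dots> = 2 * (1 + v (2 * m + 3)) * N (2 * m + 3)"
    using h_eq_N[of "Suc m"] by (simp add: numeral_3_eq_3)
  also have "\<dots> = (1 - v (2 * m + 1)) * (1 - (v (2 * m + 2))\<^sup>2) * (1 + v (2 * m + 3)) * ?H"
    unfolding h_eq_N N by (simp only: power2_eq_square) (simp add: algebra_simps)
  finally have "4 * d (Suc (Suc m)) * ?H = \<dots>" .
  moreover have "?H \<noteq> 0" using h_pos[of "Suc m"] by simp
  ultimately show ?thesis by (simp only: mult_right_cancel not_False_eq_True)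
qed

lemma coeff_\<Phi>s_1_Suc: "coeff (\<Phi>s (Suc n)) 1 = coeff (\<Phi>s n) 1 - of_real (v n) * coeff (\<Phi> n) 0"
  by (simp add: \<Phi>s_Suc verb_eq)

text \<open>The shifted summand in \<open>lift_eq\<close> contributes the constant term of
  \<open>\<Phi> (2 * m + 1)\<close>, which is minus a Verblunsky coefficient.\<close>

lemma coeff_lift_1_eq: "coeff (lift (Suc m)) 1 = coeff (\<Phi>s (2 * m + 1)) 1 - of_real (v (2 * m))"
  using coeff_\<Phi>_Suc_0[of "2 * m"] by (simp add: lift_eq verb_eq)

lemma geronimus_b_0: "2 * b 1 = 2 * v 0"
proof -
  have "of_real (2 * b 1) = (of_real (2 * v 0) :: complex)"
    using coeff_lift_1[of 0] coeff_lift_1_eq[of 0] coeff_\<Phi>s_1_Suc[of 0] by simp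
  then show ?thesis by (simp only: of_real_eq_iff)
qed

text \<open>By \<open>coeff_lift_1\<close>, twice b is the drop between consecutive z-coefficients
  of \<open>lift\<close>; two steps of the recursion for \<open>\<Phi>s\<close> evaluate it.\<close>

lemma geronimus_b_Suc:
  "2 * b (Suc (Suc m)) = (1 - v (2 * m + 1)) * v (2 * m + 2) - (1 + v (2 * m + 1)) * v (2 * m)"
proof -
  have "coeff (\<Phi>s (2 * m + 3)) 1 = coeff (\<Phi>s (2 * m + 1)) 1
      + of_real (v (2 * m + 1)) * of_real (v (2 * m)) + of_real (v (2 * m + 2)) * of_real (v (2 * m + 1))"
    using coeff_\<Phi>s_1_Suc[of "2 * m + 1"] coeff_\<Phi>s_1_Suc[of "2 * m + 2"]
      coeff_\<Phi>_Suc_0[of "2 * m"] coeff_\<Phi>_Suc_0[of "2 * m + 1"]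
    by (simp add: verb_eq numeral_3_eq_3)
  moreover have "of_real (2 * b (Suc (Suc m))) = coeff (lift (Suc m)) 1 - coeff (lift (Suc (Suc m))) 1"
    unfolding coeff_lift_1[of "Suc m"] by simp
  ultimately have "of_real (2 * b (Suc (Suc m))) =
    (of_real ((1 - v (2 * m + 1)) * v (2 * m + 2) - (1 + v (2 * m + 1)) * v (2 * m)) :: complex)"
    unfolding coeff_lift_1_eq by (simp add: numeral_3_eq_3 algebra_simps)
  then show ?thesis by (simp only: of_real_eq_iff)
qed

lemma verblunsky_Sz: "verblunsky (Sz \<nu>) (int n) = of_real (v n)"
  by (simp add: verblunsky_eq verb_eq)

lemma verblunsky_Sz_odd_neq_1: "verblunsky (Sz \<nu>) (2 * int m - 1) \<noteq> 1"
proof (cases m)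
  case 0
  then show ?thesis by (simp add: verblunsky_def)
next
  case (Suc i)
  then have "2 * int m - 1 = int (2 * i + 1)" by simp
  then show ?thesis using v_neq_1 by (simp only: verblunsky_Sz of_real_eq_1_iff not_False_eq_True)
qed

lemma verblunsky_Sz_even_neq_1: "(verblunsky (Sz \<nu>) (2 * int m))\<^sup>2 \<noteq> 1"
  using v_square_less_1[of "2 * m"] verblunsky_Sz[of "2 * m"]
  by (simp flip: of_real_power)

text \<open>The convention \<alpha>_(-1) = -1 turns the first factor into the 2 of
  \<open>geronimus_d_0\<close>, so one formula covers every \<open>m\<close>.\<close>

lemma geronimus_d:
  "of_real (4 * d (m + 1)) = (1 - verblunsky (Sz \<nu>) (2 * int m - 1)) *
     (1 - (verblunsky (Sz \<nu>) (2 * int m))\<^sup>2) * (1 + verblunsky (Sz \<nu>) (2 * int m + 1))"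
proof (cases m)
  case 0
  have "verblunsky (Sz \<nu>) 0 = of_real (v 0)" "verblunsky (Sz \<nu>) 1 = of_real (v 1)"
    using verblunsky_Sz[of 0] verblunsky_Sz[of 1] by simp_all
  then show ?thesis using 0 geronimus_d_0
    by (simp add: verblunsky_def[of _ "-1"])
next
  case (Suc i)
  have "verblunsky (Sz \<nu>) (2 * int m - 1) = of_real (v (2 * i + 1))"
    "verblunsky (Sz \<nu>) (2 * int m) = of_real (v (2 * i + 2))"
    "verblunsky (Sz \<nu>) (2 * int m + 1) = of_real (v (2 * i + 3))"
    unfolding verblunsky_Sz[symmetric] using Suc by (simp_all add: algebra_simps)
  moreover have "m + 1 = Suc (Suc i)" using Suc by simp
  ultimately show ?thesis by (simp only: geronimus_d_Suc) simp
qed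

text \<open>At \<open>m = 0\<close> the factor 1 + \<alpha>_(-1) = 0 removes the out-of-range value
  at index -2.\<close>

lemma geronimus_b:
  "of_real (2 * b (m + 1)) = (1 - verblunsky (Sz \<nu>) (2 * int m - 1)) * verblunsky (Sz \<nu>) (2 * int m)
     - (1 + verblunsky (Sz \<nu>) (2 * int m - 1)) * verblunsky (Sz \<nu>) (2 * int m - 2)"
proof (cases m)
  case 0
  have "verblunsky (Sz \<nu>) 0 = of_real (v 0)" using verblunsky_Sz[of 0] by simp
  then show ?thesis using 0 geronimus_b_0 by (simp add: verblunsky_def[of _ "-1"])
next
  case (Suc i)
  have "verblunsky (Sz \<nu>) (2 * int m - 1) = of_real (v (2 * i + 1))"
    "verblunsky (Sz \<nu>) (2 * int m) = of_real (v (2 * i + 2))"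
    "verblunsky (Sz \<nu>) (2 * int m - 2) = of_real (v (2 * i))"
    unfolding verblunsky_Sz[symmetric] using Suc by (simp_all add: algebra_simps)
  moreover have "m + 1 = Suc (Suc i)" using Suc by simp
  ultimately show ?thesis by (simp only: geronimus_b_Suc) simp
qed

lemma verblunsky_Sz_odd:
  "verblunsky (Sz \<nu>) (2 * int m + 1) = - 1 + of_real (4 * d (m + 1)) /
     ((1 - verblunsky (Sz \<nu>) (2 * int m - 1)) * (1 - (verblunsky (Sz \<nu>) (2 * int m))\<^sup>2))"
  using verblunsky_Sz_odd_neq_1[of m] verblunsky_Sz_even_neq_1[of m] unfolding geronimus_d by simp

lemma verblunsky_Sz_even:
  "verblunsky (Sz \<nu>) (2 * int m) =
     (of_real (2 * b (m + 1)) + (1 + verblunsky (Sz \<nu>) (2 * int m - 1)) * verblunsky (Sz \<nu>) (2 * int m - 2)) /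
     (1 - verblunsky (Sz \<nu>) (2 * int m - 1))"
  using verblunsky_Sz_odd_neq_1[of m] unfolding geronimus_b by simp

end

section \<open>Perturbation of the recurrence coefficients\<close>

theorem theorem9:
  fixes \<mu> \<mu>h :: "real measure"
    and b d bh dh :: "nat \<Rightarrow> real"
    and k :: nat
    and lam tau :: real
    and \<alpha> \<alpha>h :: "int \<Rightarrow> complex"
    and M :: complex
  assumes "prob_measure_on {-1..1} \<mu>"
    and "nontrivial_measure \<mu>"
    and "recurrence_coeffs \<mu> b d"
    and "k \<ge> 1"
    and "lam > 0"
    and "\<And>n. n \<ge> 1 \<Longrightarrow> dh n = lam ^ of_bool (n = k) * d n"
    and "\<And>n. n \<ge> 1 \<Longrightarrow> bh n = b n + tau * of_bool (n = k + 1)"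
    and "prob_measure_on {-1..1} \<mu>h"
    and "monic_ops_line \<mu>h (three_term_poly bh dh)"
    and "\<alpha> = verblunsky (Sz \<mu>)"
    and "\<alpha>h = verblunsky (Sz \<mu>h)"
    and "M = of_real (4 * (lam - 1) * d k) /
               ((1 - \<alpha> (2 * int k - 3)) * (1 - (\<alpha> (2 * int k - 2))\<^sup>2))"
  shows "(\<forall>n. 0 \<le> n \<and> n < 2 * int k - 1 \<longrightarrow> \<alpha>h n = \<alpha> n) \<and>
    \<alpha>h (2 * int k - 1) = \<alpha> (2 * int k - 1) + M \<and>
    \<alpha>h (2 * int k) =
      ((1 - \<alpha> (2 * int k - 1)) * \<alpha> (2 * int k) + 2 * of_real tau + M * \<alpha> (2 * int k - 2)) /
      (1 - \<alpha> (2 * int k - 1) - M) \<and>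
    (\<forall>m\<ge>k. \<alpha>h (2 * int m + 1) =
      - 1 + of_real (4 * d (m + 1)) /
        ((1 - \<alpha>h (2 * int m - 1)) * (1 - (\<alpha>h (2 * int m))\<^sup>2))) \<and>
    (\<forall>m\<ge>k + 1. \<alpha>h (2 * int m) =
      (of_real (2 * b (m + 1)) + (1 + \<alpha>h (2 * int m - 1)) * \<alpha>h (2 * int m - 2)) /
      (1 - \<alpha>h (2 * int m - 1)))"
proof -
  have pos: "0 < d n" "0 < dh n" if "n \<ge> 1" for n
    using assms(3,5,6) that by (auto simp: recurrence_coeffs_def)
  interpret \<mu>: jacobi_measure \<mu> b d
    using assms(1,3) pos by unfold_locales (auto simp: recurrence_coeffs_def)
  interpret \<mu>h: jacobi_measure \<mu>h bh dh
    using assms(8,9) pos by unfold_locales auto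
  note \<alpha> = assms(10) and \<alpha>h = assms(11) and M = assms(12)
  have odd: "\<alpha> (2 * int m + 1) = - 1 + of_real (4 * d (m + 1)) /
      ((1 - \<alpha> (2 * int m - 1)) * (1 - (\<alpha> (2 * int m))\<^sup>2))"
    and oddh: "\<alpha>h (2 * int m + 1) = - 1 + of_real (4 * dh (m + 1)) /
      ((1 - \<alpha>h (2 * int m - 1)) * (1 - (\<alpha>h (2 * int m))\<^sup>2))"
    and even: "\<alpha> (2 * int m) = (of_real (2 * b (m + 1)) + (1 + \<alpha> (2 * int m - 1)) * \<alpha> (2 * int m - 2)) /
      (1 - \<alpha> (2 * int m - 1))"
    and evenh: "\<alpha>h (2 * int m) = (of_real (2 * bh (m + 1)) + (1 + \<alpha>h (2 * int m - 1)) * \<alpha>h (2 * int m - 2)) /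
      (1 - \<alpha>h (2 * int m - 1))" for m
    unfolding \<alpha> \<alpha>h by (rule \<mu>.verblunsky_Sz_odd \<mu>h.verblunsky_Sz_odd \<mu>.verblunsky_Sz_even \<mu>h.verblunsky_Sz_even)+
  \<comment> \<open>The even recursion at \<open>m = 0\<close> mentions index -2. There
    \<open>nat\<close> truncates to 0, so both sides are -1 and the induction can start at
    -2.\<close>
  have init: "\<alpha>h (-1) = \<alpha> (-1)" "\<alpha>h (-2) = \<alpha> (-2)"
    unfolding \<alpha> \<alpha>h by (simp_all add: verblunsky_def \<mu>.monic_opuc_eq \<mu>h.monic_opuc_eq)
  \<comment> \<open>Below 2k-1 the recursions only use d up to index k-1 and b up to index k, where
    nothing is perturbed.\<close>
  have agree: "\<alpha>h n = \<alpha> n" if "- 2 \<le> n" "n < 2 * int k - 1" for n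
    using that
  proof (induction "nat (n + 2)" arbitrary: n rule: less_induct)
    case less
    have IH: "\<alpha>h i = \<alpha> i" if "- 2 \<le> i" "i < n" for i
      using less.hyps[of i] less.prems that by simp
    show ?case
    proof (cases "n < 0")
      case True
      then have "n = - 1 \<or> n = - 2" using less.prems by auto
      then show ?thesis using init by auto
    next
      case False
      define m where "m = nat (n div 2)"
      show ?thesis
      proof (cases "even n")
        case True
        then have n: "n = 2 * int m" using False by (simp add: m_def)
        then have "bh (m + 1) = b (m + 1)" using assms(7)[of "m + 1"] less.prems by simp
        then show ?thesis unfolding n evenh[of m] even[of m] using IH n by simp
      next
        case odd': False
        then have n: "n = 2 * int m + 1" using False by (simp add: m_def)
        then have "dh (m + 1) = d (m + 1)" using assms(6)[of "m + 1"] less.prems by simp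
        then show ?thesis unfolding n oddh[of m] odd[of m] using IH n by simp
      qed
    qed
  qed
  define j where "j = k - 1"
  have k: "k = Suc j" using assms(4) by (simp add: j_def)
  have e: "2 * int k - 1 = 2 * int j + 1" "2 * int k - 2 = 2 * int j" "2 * int k - 3 = 2 * int j - 1"
    using k by simp_all
  \<comment> \<open>Both odd recursions have the same denominator by \<open>agree\<close>; the
    numerators differ by 4 (lam - 1) d_k, which yields \<open>M\<close>.\<close>
  have 2: "\<alpha>h (2 * int k - 1) = \<alpha> (2 * int k - 1) + M"
  proof -
    have ag: "\<alpha>h (2 * int j - 1) = \<alpha> (2 * int j - 1)" "\<alpha>h (2 * int j) = \<alpha> (2 * int j)"
      using k by (auto intro!: agree)
    have "dh (j + 1) = lam * d (j + 1)" using assms(6)[of "j + 1"] k by simp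
    then show ?thesis unfolding M e oddh[of j] odd[of j] ag
      using k by (simp add: algebra_simps diff_divide_distrib add_divide_distrib)
  qed
  have 3: "\<alpha>h (2 * int k) =
      ((1 - \<alpha> (2 * int k - 1)) * \<alpha> (2 * int k) + 2 * of_real tau + M * \<alpha> (2 * int k - 2)) /
      (1 - \<alpha> (2 * int k - 1) - M)"
  proof -
    have ag: "\<alpha>h (2 * int k - 2) = \<alpha> (2 * int k - 2)" using k by (intro agree) auto
    have bk: "bh (k + 1) = b (k + 1) + tau" using assms(7)[of "k + 1"] by simp
    \<comment> \<open>The unperturbed relation eliminates b_(k+1) from the numerator of
      \<open>evenh\<close>, leaving the contributions of \<open>tau\<close> and
      \<open>M\<close>.\<close>
    have "(1 - \<alpha> (2 * int k - 1)) * \<alpha> (2 * int k)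
        = of_real (2 * b (k + 1)) + (1 + \<alpha> (2 * int k - 1)) * \<alpha> (2 * int k - 2)"
      using \<mu>.geronimus_b[of k] by (simp add: \<alpha>)
    then show ?thesis unfolding evenh[of k] ag 2 bk by (simp add: algebra_simps)
  qed
  \<comment> \<open>Past the perturbed indices the recursions for \<open>\<alpha>h\<close> use the
    original coefficients; b is restored one step later than d.\<close>
  have "dh (m + 1) = d (m + 1)" if "m \<ge> k" for m using assms(6)[of "m + 1"] that by simp
  moreover have "bh (m + 1) = b (m + 1)" if "m \<ge> k + 1" for m using assms(7)[of "m + 1"] that by simp
  ultimately show ?thesis using agree 2 3 oddh evenh by auto
qed

end
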